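(* Let $M$ be a complete Riemannian manifold of dimension $n$, with geodesic distance $d(x,y)$ and Riemannian volume measure $dy$, let $s\in(0,1)$, and for $u:M\to\mathbb{R}$ let $$\mathcal{L}u(x)=\int_M\frac{u(x)-u(y)}{d(x,y)^{n+2s}}\,dy .$$ Let $\varphi:\mathbb{R}\to\mathbb{R}$ be a convex function of class $C^2$, let $u:M\to\mathbb{R}$, and let $x\in M$ be a point at which $\mathcal{L}u(x)$ and $\mathcal{L}(\varphi\circ u)(x)$ exist. Then $$\mathcal{L}(\varphi\circ u)(x)\;\le\;\varphi'(u(x))\,\mathcal{L}u(x).$$
   Context: The integral defining $\mathcal{L}u(x)$ is understood in the principal value sense, i.e. as the limit as $\varepsilon\to0^+$ of the (absolutely convergent) integrals over $\{y\in M:d(x,y)>\varepsilon\}$; "exist" means that these truncated integrals converge absolutely and have a finite limit. *)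

theory Defs
  imports "HOL-Analysis.Analysis"
begin

text \<open>Both notions are meant for open sets \<open>S\<close>.\<close>

fun Ck_on :: "nat \<Rightarrow> 'b::real_normed_vector set \<Rightarrow> ('b \<Rightarrow> 'c::real_normed_vector) \<Rightarrow> bool" where
  "Ck_on 0 S f \<longleftrightarrow> continuous_on S f"
| "Ck_on (Suc k) S f \<longleftrightarrow>
     (\<forall>x\<in>S. f differentiable (at x)) \<and> (\<forall>v. Ck_on k S (\<lambda>x. frechet_derivative f (at x) v))"

definition smooth_on :: "'b::real_normed_vector set \<Rightarrow> ('b \<Rightarrow> 'c::real_normed_vector) \<Rightarrow> bool" where
  "smooth_on S f \<longleftrightarrow> (\<forall>k. Ck_on k S f)"

text \<open>A chart is a pair of a domain and a coordinate map. The coordinate map is a total function of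
  which only the values on the domain matter.\<close>

type_synonym ('a, 'n) chart = "'a set \<times> ('a \<Rightarrow> real ^ 'n)"

definition chart_inv :: "('a, 'n) chart \<Rightarrow> real ^ 'n \<Rightarrow> 'a" where
  "chart_inv c = inv_into (fst c) (snd c)"

definition transition :: "('a, 'n) chart \<Rightarrow> ('a, 'n) chart \<Rightarrow> real ^ 'n \<Rightarrow> real ^ 'n" where
  "transition c c' = snd c' \<circ> chart_inv c"

locale smooth_manifold =
  fixes X :: "'a topology" and A :: "('a, 'n::finite) chart set"
  assumes Hausdorff: "Hausdorff_space X"
    and second_countable: "second_countable X"
    and chart_domain: "c \<in> A \<Longrightarrow> openin X (fst c)"
    and chart_range: "c \<in> A \<Longrightarrow> open (snd c ` fst c)"
    and chart_homeo: "c \<in> A \<Longrightarrow>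
      homeomorphic_map (subtopology X (fst c)) (top_of_set (snd c ` fst c)) (snd c)"
    and charts_cover: "(\<Union>c\<in>A. fst c) = topspace X"
    and compatible: "c \<in> A \<Longrightarrow> c' \<in> A \<Longrightarrow>
      smooth_on (snd c ` (fst c \<inter> fst c')) (transition c c')"

text \<open>The metric tensor is given by its components: \<open>g c p\<close> is the Gram matrix at \<open>p\<close> of the
  coordinate frame of the chart \<open>c\<close>, and the last assumption is the transformation law of a
  covariant 2-tensor.\<close>

locale riemannian_manifold = smooth_manifold X A
  for X :: "'a topology" and A :: "('a, 'n::finite) chart set" +
  fixes g :: "('a, 'n) chart \<Rightarrow> 'a \<Rightarrow> real ^ 'n ^ 'n"
  assumes metric_symmetric: "c \<in> A \<Longrightarrow> p \<in> fst c \<Longrightarrow> transpose (g c p) = g c p"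
    and metric_pos_def: "c \<in> A \<Longrightarrow> p \<in> fst c \<Longrightarrow> v \<noteq> 0 \<Longrightarrow> 0 < v \<bullet> (g c p *v v)"
    and metric_smooth: "c \<in> A \<Longrightarrow> smooth_on (snd c ` fst c) (\<lambda>z. g c (chart_inv c z))"
    and metric_transform: "c \<in> A \<Longrightarrow> c' \<in> A \<Longrightarrow> p \<in> fst c \<inter> fst c' \<Longrightarrow>
      J = matrix (frechet_derivative (transition c c') (at (snd c p))) \<Longrightarrow>
      g c p = transpose J ** g c' p ** J"

definition C1_arc :: "'a topology \<Rightarrow> ('a, 'n::finite) chart set \<Rightarrow> real \<Rightarrow> real \<Rightarrow> (real \<Rightarrow> 'a) \<Rightarrow> bool" where
  "C1_arc X A a b \<gamma> \<longleftrightarrow>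
     continuous_map (top_of_set {a..b}) X \<gamma> \<and>
     (\<forall>c\<in>A. let T = {t \<in> {a..b}. \<gamma> t \<in> fst c} in
        \<exists>v. continuous_on T v \<and>
            (\<forall>t\<in>T. ((snd c \<circ> \<gamma>) has_vector_derivative v t) (at t within T)))"

definition piecewise_C1_path :: "'a topology \<Rightarrow> ('a, 'n::finite) chart set \<Rightarrow> (real \<Rightarrow> 'a) \<Rightarrow> bool" where
  "piecewise_C1_path X A \<gamma> \<longleftrightarrow>
     (\<exists>S. finite S \<and> {0, 1} \<subseteq> S \<and> S \<subseteq> {0..1} \<and>
        (\<forall>a\<in>S. \<forall>b\<in>S. a < b \<and> S \<inter> {a<..<b} = {} \<longrightarrow> C1_arc X A a b \<gamma>))"

text \<open>By the transformation law the speed does not depend on the chart around \<open>\<gamma> t\<close> that is chosen;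
  at the finitely many break points the value is irrelevant for the length.\<close>

definition speed ::
  "('a, 'n::finite) chart set \<Rightarrow> (('a, 'n) chart \<Rightarrow> 'a \<Rightarrow> real ^ 'n ^ 'n) \<Rightarrow> (real \<Rightarrow> 'a) \<Rightarrow> real \<Rightarrow> real" where
  "speed A g \<gamma> t =
     (let c = (SOME c. c \<in> A \<and> \<gamma> t \<in> fst c);
          v = vector_derivative (snd c \<circ> \<gamma>) (at t)
      in sqrt (v \<bullet> (g c (\<gamma> t) *v v)))"

definition path_length ::
  "('a, 'n::finite) chart set \<Rightarrow> (('a, 'n) chart \<Rightarrow> 'a \<Rightarrow> real ^ 'n ^ 'n) \<Rightarrow> (real \<Rightarrow> 'a) \<Rightarrow> ennreal" where
  "path_length A g \<gamma> = (\<integral>\<^sup>+ t \<in> {0..1}. ennreal (speed A g \<gamma> t) \<partial>lborel)"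

text \<open>Connectedness is not assumed: the distance of points in different components is \<open>\<infinity>\<close>.\<close>

definition geodesic_dist ::
  "'a topology \<Rightarrow> ('a, 'n::finite) chart set \<Rightarrow> (('a, 'n) chart \<Rightarrow> 'a \<Rightarrow> real ^ 'n ^ 'n) \<Rightarrow>
   'a \<Rightarrow> 'a \<Rightarrow> ennreal" where
  "geodesic_dist X A g p q =
     (INF \<gamma> \<in> {\<gamma>. piecewise_C1_path X A \<gamma> \<and> \<gamma> 0 = p \<and> \<gamma> 1 = q}. path_length A g \<gamma>)"

locale complete_riemannian_manifold = riemannian_manifold X A g
  for X :: "'a topology" and A :: "('a, 'n::finite) chart set" and g +
  assumes complete: "\<And>\<sigma> :: nat \<Rightarrow> 'a. range \<sigma> \<subseteq> topspace X \<Longrightarrow>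
      (\<And>\<epsilon>. 0 < \<epsilon> \<Longrightarrow> \<exists>N. \<forall>i\<ge>N. \<forall>j\<ge>N. geodesic_dist X A g (\<sigma> i) (\<sigma> j) < \<epsilon>) \<Longrightarrow>
      \<exists>p \<in> topspace X. (\<lambda>i. geodesic_dist X A g (\<sigma> i) p) \<longlonglongrightarrow> 0"

text \<open>These conditions determine the measure uniquely, because countably many chart domains cover the
  manifold.\<close>

definition is_riemannian_volume ::
  "'a topology \<Rightarrow> ('a, 'n::finite) chart set \<Rightarrow> (('a, 'n) chart \<Rightarrow> 'a \<Rightarrow> real ^ 'n ^ 'n) \<Rightarrow>
   'a measure \<Rightarrow> bool" where
  "is_riemannian_volume X A g vol \<longleftrightarrow>
     space vol = topspace X \<and>
     sets vol = sigma_sets (topspace X) {U. openin X U} \<and>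
     (\<forall>c\<in>A. \<forall>B\<in>sets vol. B \<subseteq> fst c \<longrightarrow>
        emeasure vol B =
          (\<integral>\<^sup>+ z \<in> snd c ` B. ennreal (sqrt (det (g c (chart_inv c z)))) \<partial>lborel))"

text \<open>For points at infinite distance the quotient is \<open>0\<close>, since \<open>enn2real \<infinity> = 0\<close>, \<open>0 powr _ = 0\<close>
  and division by \<open>0\<close> gives \<open>0\<close>. Points at distance \<open>0\<close> are never integrated over.\<close>

definition frac_quotient ::
  "'a topology \<Rightarrow> ('a, 'n::finite) chart set \<Rightarrow> (('a, 'n) chart \<Rightarrow> 'a \<Rightarrow> real ^ 'n ^ 'n) \<Rightarrow>
   real \<Rightarrow> ('a \<Rightarrow> real) \<Rightarrow> 'a \<Rightarrow> 'a \<Rightarrow> real" where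
  "frac_quotient X A g s u x y =
     (u x - u y) / enn2real (geodesic_dist X A g x y) powr (real CARD('n) + 2 * s)"

definition dist_exterior ::
  "'a topology \<Rightarrow> ('a, 'n::finite) chart set \<Rightarrow> (('a, 'n) chart \<Rightarrow> 'a \<Rightarrow> real ^ 'n ^ 'n) \<Rightarrow>
   'a \<Rightarrow> real \<Rightarrow> 'a set" where
  "dist_exterior X A g x \<epsilon> = {y \<in> topspace X. ennreal \<epsilon> < geodesic_dist X A g x y}"

text \<open>Integration is with respect to the completion of the volume measure, so that all
  Lebesgue-measurable functions on the manifold are admitted.\<close>

definition truncated_frac_laplacian ::
  "'a topology \<Rightarrow> ('a, 'n::finite) chart set \<Rightarrow> (('a, 'n) chart \<Rightarrow> 'a \<Rightarrow> real ^ 'n ^ 'n) \<Rightarrow>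
   'a measure \<Rightarrow> real \<Rightarrow> ('a \<Rightarrow> real) \<Rightarrow> 'a \<Rightarrow> real \<Rightarrow> real" where
  "truncated_frac_laplacian X A g vol s u x \<epsilon> =
     (LINT y : dist_exterior X A g x \<epsilon> | completion vol. frac_quotient X A g s u x y)"

definition frac_laplacian_exists ::
  "'a topology \<Rightarrow> ('a, 'n::finite) chart set \<Rightarrow> (('a, 'n) chart \<Rightarrow> 'a \<Rightarrow> real ^ 'n ^ 'n) \<Rightarrow>
   'a measure \<Rightarrow> real \<Rightarrow> ('a \<Rightarrow> real) \<Rightarrow> 'a \<Rightarrow> bool" where
  "frac_laplacian_exists X A g vol s u x \<longleftrightarrow>
     (\<forall>\<epsilon>>0. set_integrable (completion vol) (dist_exterior X A g x \<epsilon>) (frac_quotient X A g s u x)) \<and>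
     (\<exists>L. (truncated_frac_laplacian X A g vol s u x \<longlongrightarrow> L) (at_right 0))"

definition frac_laplacian ::
  "'a topology \<Rightarrow> ('a, 'n::finite) chart set \<Rightarrow> (('a, 'n) chart \<Rightarrow> 'a \<Rightarrow> real ^ 'n ^ 'n) \<Rightarrow>
   'a measure \<Rightarrow> real \<Rightarrow> ('a \<Rightarrow> real) \<Rightarrow> 'a \<Rightarrow> real" where
  "frac_laplacian X A g vol s u x = Lim (at_right 0) (truncated_frac_laplacian X A g vol s u x)"

end

theory Submission
  imports Defs
begin

text \<open>A convex function lies above its tangent at \<open>u x\<close>, so \<phi>(u x) -
  \<phi>(u y) \<le> \<phi>'(u x) (u x - u y) for every \<open>y\<close>. Dividing by the nonnegative
  power of the distance compares the integrands pointwise (\<open>frac_quotient_comp_le\<close>).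
  The slope does not depend on \<open>y\<close>, so the comparison survives integration over each
  truncated domain (\<open>truncated_frac_laplacian_comp_le\<close>) and then the limit \<epsilon>
  \<rightarrow> 0.\<close>

lemma frac_quotient_comp_le:
  assumes "convex_on UNIV \<phi>" and "(\<phi> has_real_derivative d) (at (u x))"
  shows "frac_quotient X A g s (\<phi> \<circ> u) x y \<le> d * frac_quotient X A g s u x y"
proof -
  have "\<phi> (u y) - \<phi> (u x) \<ge> d * (u y - u x)"
    using assms by (intro convex_on_imp_above_tangent[of UNIV]) auto
  then have "\<phi> (u x) - \<phi> (u y) \<le> d * (u x - u y)"
    by (simp add: algebra_simps)
  \<comment> \<open>The denominator is a value of \<open>powr\<close>, hence nonnegative. Where it
    vanishes (distance 0 or infinite), both quotients are 0 by convention, so no \<open>y\<close>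
    has to be excluded.\<close>
  then show ?thesis
    unfolding frac_quotient_def comp_def times_divide_eq_right
    by (rule divide_right_mono) simp
qed

text \<open>Existence includes absolute convergence of both truncated integrals, which is what
  monotonicity of the integral requires.\<close>

lemma truncated_frac_laplacian_comp_le:
  assumes "convex_on UNIV \<phi>" and "(\<phi> has_real_derivative d) (at (u x))"
    and "frac_laplacian_exists X A g vol s u x"
    and "frac_laplacian_exists X A g vol s (\<phi> \<circ> u) x"
    and "0 < \<epsilon>"
  shows "truncated_frac_laplacian X A g vol s (\<phi> \<circ> u) x \<epsilon>
    \<le> d * truncated_frac_laplacian X A g vol s u x \<epsilon>"
proof -
  have "set_integrable (completion vol) (dist_exterior X A g x \<epsilon>) (frac_quotient X A g s u x)"
    and "set_integrable (completion vol) (dist_exterior X A g x \<epsilon>) (frac_quotient X A g s (\<phi> \<circ> u) x)"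
    using assms(3-5) unfolding frac_laplacian_exists_def by blast+
  then show ?thesis
    \<comment> \<open>The constant \<open>d\<close> moves under the integral sign, so that the two
      integrands can be compared pointwise.\<close>
    unfolding truncated_frac_laplacian_def set_integral_mult_right[symmetric]
    by (intro set_integral_mono set_integrable_mult_right frac_quotient_comp_le assms)
qed

text \<open>Limits along the nontrivial filter \<open>at_right 0\<close> are unique, so
  \<open>Lim\<close> picks out the limit whose existence is assumed.\<close>

lemma tendsto_frac_laplacian:
  assumes "frac_laplacian_exists X A g vol s u x"
  shows "(truncated_frac_laplacian X A g vol s u x \<longlongrightarrow> frac_laplacian X A g vol s u x) (at_right 0)"
  using assms tendsto_Lim[OF trivial_limit_at_right_real]
  unfolding frac_laplacian_exists_def frac_laplacian_def by metis

theorem mainTheorem7: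
  fixes X :: "'a topology"
    and A :: "('a, 'n::finite) chart set"
    and g :: "('a, 'n) chart \<Rightarrow> 'a \<Rightarrow> real ^ 'n ^ 'n"
    and vol :: "'a measure"
    and s :: real
    and \<phi> \<phi>' \<phi>'' :: "real \<Rightarrow> real"
    and u :: "'a \<Rightarrow> real"
    and x :: 'a
  assumes "complete_riemannian_manifold X A g"
    and "is_riemannian_volume X A g vol"
    and "0 < s" and "s < 1"
    and "convex_on UNIV \<phi>"
    and "\<And>t. (\<phi> has_real_derivative \<phi>' t) (at t)"
    and "\<And>t. (\<phi>' has_real_derivative \<phi>'' t) (at t)"
    and "continuous_on UNIV \<phi>''"
    and "x \<in> topspace X"
    and "frac_laplacian_exists X A g vol s u x"
    and "frac_laplacian_exists X A g vol s (\<phi> \<circ> u) x"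
  shows "frac_laplacian X A g vol s (\<phi> \<circ> u) x \<le> \<phi>' (u x) * frac_laplacian X A g vol s u x"
proof (rule tendsto_le[OF trivial_limit_at_right_real])
  show "((\<lambda>\<epsilon>. \<phi>' (u x) * truncated_frac_laplacian X A g vol s u x \<epsilon>)
      \<longlongrightarrow> \<phi>' (u x) * frac_laplacian X A g vol s u x) (at_right 0)"
    using assms(10) by (intro tendsto_mult_left tendsto_frac_laplacian)
  show "(truncated_frac_laplacian X A g vol s (\<phi> \<circ> u) x
      \<longlongrightarrow> frac_laplacian X A g vol s (\<phi> \<circ> u) x) (at_right 0)"
    using assms(11) by (rule tendsto_frac_laplacian)
  show "\<forall>\<^sub>F \<epsilon> in at_right 0. truncated_frac_laplacian X A g vol s (\<phi> \<circ> u) x \<epsilon>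
      \<le> \<phi>' (u x) * truncated_frac_laplacian X A g vol s u x \<epsilon>"
    \<comment> \<open>Near 0 from the right \<epsilon> is positive, which is all that the truncated
      inequality asks of it.\<close>
    using eventually_at_right_less
    by eventually_elim (intro truncated_frac_laplacian_comp_le assms)
qed

end
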